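(* Let $(k_{1},\ldots,k_{r})$ be an admissible index. Then $$\sum_{1\le i\le r}\zeta_{q}(k_{1},\ldots,k_{i}+1,\ldots,k_{r})=\sum_{\substack{1\le i\le r\\ k_{i}\ge2}}\ \sum_{a=0}^{k_{i}-2}\zeta_{q}(k_{1},\ldots,k_{i-1},k_{i}-a,a+1,k_{i+1},\ldots,k_{r}).$$
   Context: Fix a complex number $q$ with $0<|q|<1$ and set $[n]:=\frac{1-q^{n}}{1-q}$. An admissible index is an ordered tuple $(k_{1},\ldots,k_{r})$ of positive integers (with $r\ge 1$) such that $k_{1}\ge2$. For an admissible index, the $q$-analogue of the multiple zeta value is $\zeta_{q}(k_{1},\ldots,k_{r}):=\sum_{n_{1}>\cdots>n_{r}>0}\frac{q^{(k_{1}-1)n_{1}+\cdots+(k_{r}-1)n_{r}}}{[n_{1}]^{k_{1}}\cdots[n_{r}]^{k_{r}}}$, the sum being over positive integers. *)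

theory Defs
  imports "HOL-Analysis.Analysis"
begin

definition q_int :: "complex \<Rightarrow> nat \<Rightarrow> complex" where
  "q_int q n = (1 - q ^ n) / (1 - q)"

(* An index (k_1,...,k_r) is a list, so k_i is the list entry with number i - 1. *)

definition admissible :: "nat list \<Rightarrow> bool" where
  "admissible ks \<longleftrightarrow> ks \<noteq> [] \<and> (\<forall>k\<in>set ks. 0 < k) \<and> 2 \<le> hd ks"

definition decreasing_tuples :: "nat \<Rightarrow> nat list set" where
  "decreasing_tuples r = {ns. length ns = r \<and> sorted_wrt (>) ns \<and> (\<forall>n\<in>set ns. 0 < n)}"

(* For 0 < |q| < 1 and an admissible index the series converges absolutely, since |[n]| is
   bounded away from 0 and the exponent of q is at least n_1; so infsum is its true sum
   there.  The truncated subtraction is harmless because all entries of ks are positive. *)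

definition qzeta :: "complex \<Rightarrow> nat list \<Rightarrow> complex" where
  "qzeta q ks =
     (\<Sum>\<^sub>\<infinity>ns\<in>decreasing_tuples (length ks).
        q ^ (\<Sum>j<length ks. (ks ! j - 1) * ns ! j) /
        (\<Prod>j<length ks. q_int q (ns ! j) ^ (ks ! j)))"

end

(* Write A(n) = q^n/[n], t_k(n) = q^((k-1)n)/[n]^k, and truncate every series by N > n_1.
   For 0 < m < n the sum of t_(k-a)(n) t_(a+1)(m) over a is geometric and equals
     t_k(m) (A(n-m) - A(n)) - A(n-m) t_k(n).
   Summing over m < n and n < N, and by induction on the depth, the difference of the two
   sides of the theorem for the truncated sums Z is exactly
     sum_(j<N) A(j) Z(N-j) - (sum_(j<N) A(j)) Z(N).
   As the first sum is a partial sum of the Cauchy product of two absolutely convergent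
   series, both terms have the same limit, and the difference vanishes as N grows. *)

theory Submission
  imports Defs
begin

section \<open>Truncated nested sums and the unordered sum over decreasing tuples\<close>

text \<open>The outermost variable is summed last, so induction on the index peels off the first
  entry. The ring is kept general to serve both the complex summands and their real norms.\<close>

fun trunc_sum :: "(nat \<Rightarrow> nat \<Rightarrow> 'a::comm_ring_1) \<Rightarrow> nat list \<Rightarrow> nat \<Rightarrow> 'a" where
  "trunc_sum t [] N = 1"
| "trunc_sum t (k # ks) N = (\<Sum>n<N. t k n * trunc_sum t ks n)"

definition bounded_tuples :: "nat \<Rightarrow> nat \<Rightarrow> nat list set" where
  "bounded_tuples r N = {ns \<in> decreasing_tuples r. \<forall>n\<in>set ns. n < N}"

lemma bounded_tuples_0: "bounded_tuples 0 N = {[]}"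
  by (auto simp: bounded_tuples_def decreasing_tuples_def)

lemma bounded_tuples_Suc:
  "bounded_tuples (Suc r) N = (\<lambda>(n, ns). n # ns) ` (SIGMA n:{0<..<N}. bounded_tuples r n)"
  by (fastforce simp: bounded_tuples_def decreasing_tuples_def length_Suc_conv image_iff)

lemma finite_bounded_tuples: "finite (bounded_tuples r N)"
  by (induction r arbitrary: N) (auto simp: bounded_tuples_0 bounded_tuples_Suc)

text \<open>Tuples have positive entries, whereas the nested sums start at 0; the hypothesis on
  \<open>t k 0\<close> removes the discrepancy.\<close>

lemma sum_bounded_tuples:
  assumes "\<And>k. k \<in> set ks \<Longrightarrow> t k 0 = 0"
  shows "(\<Sum>ns\<in>bounded_tuples (length ks) N. \<Prod>j<length ks. t (ks ! j) (ns ! j)) =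
    trunc_sum t ks N"
  using assms
proof (induction ks arbitrary: N)
  case Nil
  then show ?case by (simp add: bounded_tuples_0)
next
  case (Cons k ks)
  have inj: "inj_on (\<lambda>x. fst x # snd x) A" for A :: "(nat \<times> nat list) set"
    by (auto simp: inj_on_def)
  have "(\<Sum>ns\<in>bounded_tuples (length (k # ks)) N. \<Prod>j<length (k # ks). t ((k # ks) ! j) (ns ! j)) =
      (\<Sum>(n, ns)\<in>(SIGMA n:{0<..<N}. bounded_tuples (length ks) n).
         t k n * (\<Prod>j<length ks. t (ks ! j) (ns ! j)))"
    by (simp add: bounded_tuples_Suc sum.reindex[OF inj] prod.lessThan_Suc_shift case_prod_unfold
        del: prod.lessThan_Suc)
  also have "\<dots> = (\<Sum>n\<in>{0<..<N}. t k n * trunc_sum t ks n)"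
    using Cons by (simp add: sum.Sigma[symmetric] finite_bounded_tuples sum_distrib_left[symmetric])
  also have "\<dots> = (\<Sum>n<N. t k n * trunc_sum t ks n)"
    using Cons.prems by (intro sum.mono_neutral_left) auto
  finally show ?case by simp
qed

text \<open>Finitely many tuples have a largest entry, so the sets \<open>bounded_tuples r N\<close>
  are cofinal among the finite subsets. This turns an unordered sum into the limit of a
  sequence.\<close>

lemma filterlim_bounded_tuples:
  "filterlim (bounded_tuples r) (finite_subsets_at_top (decreasing_tuples r)) sequentially"
  unfolding filterlim_finite_subsets_at_top
proof (intro allI impI)
  fix X assume X: "finite X \<and> X \<subseteq> decreasing_tuples r"
  define M where "M = Max (insert 0 (\<Union>ns\<in>X. set ns))"
  have "n \<le> M" if "n \<in> set ns" "ns \<in> X" for n ns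
    unfolding M_def using X that by (intro Max_ge) auto
  then have "X \<subseteq> bounded_tuples r N" if "N > M" for N
    using X that unfolding bounded_tuples_def by fastforce
  then show "\<forall>\<^sub>F N in sequentially. finite (bounded_tuples r N) \<and> X \<subseteq> bounded_tuples r N \<and>
      bounded_tuples r N \<subseteq> decreasing_tuples r"
    by (intro eventually_mono[OF eventually_gt_at_top[of M]])
       (auto simp: finite_bounded_tuples, auto simp: bounded_tuples_def)
qed

text \<open>By cofinality every finite sum of norms is dominated by a truncation and hence by
  \<open>C\<close>. This gives absolute summability, and the limit over finite subsets can then be
  taken along \<open>bounded_tuples\<close>.\<close>

lemma infsum_decreasing_tuples:
  fixes t :: "nat \<Rightarrow> nat \<Rightarrow> complex"
  assumes t0: "\<And>k. k \<in> set ks \<Longrightarrow> t k 0 = 0"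
    and bound: "\<And>N. trunc_sum (\<lambda>k n. norm (t k n)) ks N \<le> C"
  shows "trunc_sum t ks \<longlonglongrightarrow>
    (\<Sum>\<^sub>\<infinity>ns\<in>decreasing_tuples (length ks). \<Prod>j<length ks. t (ks ! j) (ns ! j))"
proof -
  let ?f = "\<lambda>ns. \<Prod>j<length ks. t (ks ! j) (ns ! j)"
  let ?D = "decreasing_tuples (length ks)"
  have "(\<lambda>ns. norm (?f ns)) summable_on ?D"
  proof (rule nonneg_bdd_above_summable_on)
    show "bdd_above (sum (\<lambda>ns. norm (?f ns)) ` {F. F \<subseteq> ?D \<and> finite F})"
    proof (intro bdd_aboveI2[where M = C])
      fix F assume "F \<in> {F. F \<subseteq> ?D \<and> finite F}"
      then have "\<forall>\<^sub>F N in sequentially. F \<subseteq> bounded_tuples (length ks) N"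
        using filterlim_bounded_tuples[of "length ks", unfolded filterlim_finite_subsets_at_top]
        by (force elim: eventually_mono)
      then obtain N where "F \<subseteq> bounded_tuples (length ks) N"
        by (auto simp: eventually_sequentially)
      then have "(\<Sum>ns\<in>F. norm (?f ns)) \<le> (\<Sum>ns\<in>bounded_tuples (length ks) N. norm (?f ns))"
        by (intro sum_mono2 finite_bounded_tuples) auto
      also have "\<dots> = trunc_sum (\<lambda>k n. norm (t k n)) ks N"
        using t0 by (subst sum_bounded_tuples[symmetric]) (auto simp: prod_norm)
      finally show "(\<Sum>ns\<in>F. norm (?f ns)) \<le> C"
        using bound by (rule order.trans)
    qed
  qed simp
  then have "(?f has_sum infsum ?f ?D) ?D"
    by (rule has_sum_infsum[OF abs_summable_summable])
  then have "(\<lambda>N. sum ?f (bounded_tuples (length ks) N)) \<longlonglongrightarrow> infsum ?f ?D"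
    unfolding has_sum_def by (rule filterlim_compose[OF _ filterlim_bounded_tuples])
  then show ?thesis
    using sum_bounded_tuples[of ks t] t0 by simp
qed

section \<open>The summands and their partial fractions\<close>

definition qz_term :: "complex \<Rightarrow> nat \<Rightarrow> nat \<Rightarrow> complex" where
  "qz_term q k n = q ^ ((k - 1) * n) / q_int q n ^ k"

definition qz_ratio :: "complex \<Rightarrow> nat \<Rightarrow> complex" where
  "qz_ratio q n = q ^ n / q_int q n"

text \<open>The dependence on the exponent is a pure power of \<open>qz_ratio\<close>; this is what
  makes the sum over \<open>a\<close> geometric.\<close>

lemma qz_term_Suc: "qz_term q (Suc k) n = qz_ratio q n ^ k / q_int q n"
  by (simp add: qz_term_def qz_ratio_def power_divide power_mult[symmetric] mult.commute)

lemma qz_term_Suc': "0 < k \<Longrightarrow> qz_term q (Suc k) n = qz_term q k n * qz_ratio q n"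
  by (cases k) (auto simp: qz_term_Suc)

text \<open>
  Division by $[0] = 0$ gives $0$, so sums over $n < N$ may start at $n = 0$.
\<close>

lemma qz_ratio_0 [simp]: "qz_ratio q 0 = 0"
  by (simp add: qz_ratio_def q_int_def)

lemma qz_term_0 [simp]: "0 < k \<Longrightarrow> qz_term q k 0 = 0"
  by (simp add: qz_term_def q_int_def)

lemma qzeta_eq: "qzeta q ks =
    (\<Sum>\<^sub>\<infinity>ns\<in>decreasing_tuples (length ks). \<Prod>j<length ks. qz_term q (ks ! j) (ns ! j))"
  by (simp add: qzeta_def qz_term_def prod_dividef power_sum)

lemma power_neq_1:
  fixes q :: complex
  assumes "norm q < 1" "0 < n"
  shows "q ^ n \<noteq> 1"
  using assms power_eq_1_iff by fastforce

text \<open>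
  The $q$-analogues of $(1/m - 1/n)/(n-m) = 1/(mn)$ and $1/((n-m)n) = (1/(n-m) - 1/n)/m$.
\<close>

lemma qz_ratio_identities:
  assumes q: "norm q < 1" and m: "0 < m" "m < n"
  shows "qz_ratio q (n - m) * (qz_ratio q m - qz_ratio q n) = qz_ratio q n / q_int q m" (is ?A)
    and "qz_ratio q (n - m) / q_int q n = (qz_ratio q (n - m) - qz_ratio q n) / q_int q m" (is ?B)
proof -
  obtain d where n: "n = m + d" and d: "0 < d"
    using m by (metis less_imp_add_positive)
  have ne: "q ^ m \<noteq> 1" "q ^ d \<noteq> 1" "q ^ m * q ^ d \<noteq> 1" "q \<noteq> 1"
    using power_neq_1[OF q, of m] power_neq_1[OF q, of d] power_neq_1[OF q, of n] m d n q
    by (auto simp: power_add)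
  then have ne': "1 - q ^ m \<noteq> 0" "1 - q ^ d \<noteq> 0" "1 - q ^ m * q ^ d \<noteq> 0" "1 - q \<noteq> 0"
    by auto
  show ?A
    using ne' by (simp add: n qz_ratio_def q_int_def power_add divide_simps) algebra
  show ?B
    using ne' by (simp add: n qz_ratio_def q_int_def power_add divide_simps) algebra
qed

text \<open>The first identity trades A(n)/[m] for A(n-m) (A(m) - A(n)), whose last factor collapses
  the geometric sum to a difference of two powers. The second identity then moves the A(m) power
  from denominator [n] to [m].\<close>

lemma sum_qz_term_split:
  assumes q: "norm q < 1" and m: "0 < m" "m < n" and k: "0 < k"
  shows "(\<Sum>a<k - 1. qz_term q (k - a) n * qz_term q (a + 1) m) =
    qz_term q k m * (qz_ratio q (n - m) - qz_ratio q n) - qz_ratio q (n - m) * qz_term q k n"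
proof -
  obtain j where k: "k = Suc j"
    using k by (cases k) auto
  note id = qz_ratio_identities[OF q m]
  let ?x = "qz_ratio q m" and ?y = "qz_ratio q n"
  let ?S = "\<Sum>i<j. ?y ^ (j - Suc i) * ?x ^ i"
  have "(\<Sum>a<k - 1. qz_term q (k - a) n * qz_term q (a + 1) m) = ?y / q_int q n / q_int q m * ?S"
    unfolding sum_distrib_left k
  proof (rule sum.cong, simp)
    fix a assume "a \<in> {..<j}"
    \<comment> \<open>Two successors are exposed: one for \<open>qz_term_Suc\<close>, the other to
      split off a factor \<open>?y\<close>.\<close>
    then have "Suc j - a = Suc (Suc (j - Suc a))" by auto
    then show "qz_term q (Suc j - a) n * qz_term q (a + 1) m =
        ?y / q_int q n / q_int q m * (?y ^ (j - Suc a) * ?x ^ a)"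
      by (simp add: qz_term_Suc)
  qed
  also have "\<dots> = (?y / q_int q m) / q_int q n * ?S"
    by simp
  also have "\<dots> = qz_ratio q (n - m) / q_int q n * ((?x - ?y) * ?S)"
    unfolding id(1)[symmetric] by simp
  also have "(?x - ?y) * ?S = ?x ^ j - ?y ^ j"
    by (rule power_diff_sumr2[symmetric])
  also have "qz_ratio q (n - m) / q_int q n * (?x ^ j - ?y ^ j) =
      qz_ratio q (n - m) / q_int q n * ?x ^ j - qz_ratio q (n - m) * (?y ^ j / q_int q n)"
    by (simp add: algebra_simps)
  finally show ?thesis
    unfolding id(2) by (simp add: k qz_term_Suc mult_ac)
qed

section \<open>The exact identity for truncated sums\<close>

abbreviation qz_trunc :: "complex \<Rightarrow> nat list \<Rightarrow> nat \<Rightarrow> complex" where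
  "qz_trunc q \<equiv> trunc_sum (qz_term q)"

text \<open>A q-analogue of the harmonic number H_(N-1), since the term at 0 vanishes.\<close>

definition qz_harmonic :: "complex \<Rightarrow> nat \<Rightarrow> complex" where
  "qz_harmonic q N = (\<Sum>n<N. qz_ratio q n)"

definition qz_conv :: "complex \<Rightarrow> nat list \<Rightarrow> nat \<Rightarrow> complex" where
  "qz_conv q ks N = (\<Sum>j<N. qz_ratio q j * qz_trunc q ks (N - j))"

lemma qz_conv_eq: "qz_conv q ks N = (\<Sum>m\<in>{0<..<N}. qz_ratio q (N - m) * qz_trunc q ks m)"
proof -
  have "qz_conv q ks N = (\<Sum>j\<in>{0<..<N}. qz_ratio q j * qz_trunc q ks (N - j))"
    unfolding qz_conv_def by (intro sum.mono_neutral_right) auto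
  also have "\<dots> = (\<Sum>m\<in>{0<..<N}. qz_ratio q (N - m) * qz_trunc q ks m)"
    by (rule sum.reindex_bij_witness[where i = "\<lambda>m. N - m" and j = "\<lambda>m. N - m"]) auto
  finally show ?thesis .
qed

text \<open>The region i + j < N is summed along its diagonals i + j = n. The result is a partial
  sum of a Cauchy product, the form needed both in the identity and for its limit.\<close>

lemma qz_conv_Cons:
  "qz_conv q (k # ks) N =
    (\<Sum>n<N. \<Sum>i\<le>n. qz_ratio q i * (qz_term q k (n - i) * qz_trunc q ks (n - i)))"
proof -
  have "qz_conv q (k # ks) N = (\<Sum>(i, j)\<in>{(i, j). i + j < N}.
      qz_ratio q i * (qz_term q k j * qz_trunc q ks j))"
    unfolding qz_conv_def trunc_sum.simps sum_distrib_left
    by (subst sum.Sigma) (auto intro!: sum.cong)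
  then show ?thesis
    by (simp add: sum.triangle_reindex)
qed

text \<open>Summation by parts; the argument \<open>Suc m\<close> reflects the strict inequality m <
  n.\<close>

lemma sum_by_parts_harmonic:
  "(\<Sum>n<N. qz_ratio q n * (\<Sum>m<n. z m)) =
    qz_harmonic q N * (\<Sum>m<N. z m) - (\<Sum>m<N. z m * qz_harmonic q (Suc m))"
  by (induction N) (auto simp: qz_harmonic_def algebra_simps)

text \<open>The split identity is summed over m < n < N. Its three products give, in turn, the
  convolution for the whole index, the harmonic terms (by parts), and the convolution for the
  tail.\<close>

lemma trunc_hoffman_head:
  assumes q: "norm q < 1" and k: "0 < k"
  shows "(\<Sum>a<k - 1. qz_trunc q ((k - a) # (a + 1) # ks) N) =
    qz_conv q (k # ks) N - qz_harmonic q N * qz_trunc q (k # ks) N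
    + (\<Sum>n<N. qz_term q k n * qz_trunc q ks n * qz_harmonic q (Suc n))
    - (\<Sum>n<N. qz_term q k n * qz_conv q ks n)"
proof -
  let ?A = "qz_ratio q" and ?t = "qz_term q"
  define z where "z m = ?t k m * qz_trunc q ks m" for m
  have z0: "z 0 = 0"
    using k by (simp add: z_def)
  have inner: "(\<Sum>a<k - 1. ?t (k - a) n * (\<Sum>m<n. ?t (a + 1) m * qz_trunc q ks m)) =
      (\<Sum>i\<le>n. ?A i * z (n - i)) - ?A n * (\<Sum>m<n. z m) - ?t k n * qz_conv q ks n" for n
  proof -
    have "(\<Sum>a<k - 1. ?t (k - a) n * (\<Sum>m<n. ?t (a + 1) m * qz_trunc q ks m)) =
        (\<Sum>m<n. (\<Sum>a<k - 1. ?t (k - a) n * ?t (a + 1) m) * qz_trunc q ks m)"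
      unfolding sum_distrib_left sum_distrib_right by (subst sum.swap) (simp add: mult_ac)
    \<comment> \<open>The split identity needs m > 0; the term at m = 0 vanishes because
      \<open>qz_term\<close> does.\<close>
    also have "\<dots> = (\<Sum>m\<in>{0<..<n}. (\<Sum>a<k - 1. ?t (k - a) n * ?t (a + 1) m) * qz_trunc q ks m)"
      by (rule sum.mono_neutral_right) auto
    also have "\<dots> = (\<Sum>m\<in>{0<..<n}. ?A (n - m) * z m - ?A n * z m
        - ?t k n * (?A (n - m) * qz_trunc q ks m))"
    proof (rule sum.cong[OF refl])
      fix m assume "m \<in> {0<..<n}"
      then have m: "0 < m" "m < n" by auto
      show "(\<Sum>a<k - 1. ?t (k - a) n * ?t (a + 1) m) * qz_trunc q ks m =
        ?A (n - m) * z m - ?A n * z m - ?t k n * (?A (n - m) * qz_trunc q ks m)"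
        unfolding sum_qz_term_split[OF q m k] z_def by (simp add: algebra_simps)
    qed
    also have "\<dots> = (\<Sum>m\<in>{0<..<n}. ?A (n - m) * z m) - ?A n * (\<Sum>m\<in>{0<..<n}. z m)
        - ?t k n * qz_conv q ks n"
      by (simp add: sum_subtractf sum_distrib_left qz_conv_eq)
    also have "(\<Sum>m\<in>{0<..<n}. z m) = (\<Sum>m<n. z m)"
      using z0 by (intro sum.mono_neutral_left) (auto simp: not_less)
    \<comment> \<open>Both endpoints may be added: \<open>z 0\<close> vanishes, and at m = n so does
      \<open>qz_ratio q 0\<close>.\<close>
    also have "(\<Sum>m\<in>{0<..<n}. ?A (n - m) * z m) = (\<Sum>m\<le>n. ?A (n - m) * z m)"
      using z0 by (intro sum.mono_neutral_left) (auto simp: not_less le_less)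
    also have "\<dots> = (\<Sum>i\<le>n. ?A i * z (n - i))"
      by (rule sum.reindex_bij_witness[where i = "\<lambda>m. n - m" and j = "\<lambda>m. n - m"]) auto
    finally show ?thesis .
  qed
  have "(\<Sum>a<k - 1. qz_trunc q ((k - a) # (a + 1) # ks) N) =
      (\<Sum>n<N. \<Sum>a<k - 1. ?t (k - a) n * (\<Sum>m<n. ?t (a + 1) m * qz_trunc q ks m))"
    by (subst sum.swap) simp
  also have "\<dots> = qz_conv q (k # ks) N - (\<Sum>n<N. ?A n * (\<Sum>m<n. z m))
      - (\<Sum>n<N. ?t k n * qz_conv q ks n)"
    by (simp only: inner sum_subtractf qz_conv_Cons z_def)
  finally show ?thesis
    by (simp add: sum_by_parts_harmonic z_def)
qed

text \<open>
  The convolution is carried along as an exact error term: this closes the induction on the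
  index, although the tail of an admissible index need not be admissible.
\<close>

lemma trunc_hoffman:
  assumes q: "norm q < 1" and "\<forall>k\<in>set ks. 0 < k"
  shows "(\<Sum>i<length ks. \<Sum>a<ks ! i - 1.
      qz_trunc q (take i ks @ [ks ! i - a, a + 1] @ drop (i + 1) ks) N) =
    (\<Sum>i<length ks. qz_trunc q (ks[i := ks ! i + 1]) N)
    + qz_conv q ks N - qz_harmonic q N * qz_trunc q ks N"
  using assms(2)
proof (induction ks arbitrary: N)
  case Nil
  \<comment> \<open>The empty truncation is constantly 1, so the error term is zero here.\<close>
  have "qz_conv q [] N = qz_harmonic q N"
    by (simp add: qz_conv_def qz_harmonic_def)
  then show ?case by simp
next
  case (Cons k ks)
  then have k: "0 < k" by simp
  let ?L = "\<lambda>N. \<Sum>i<length ks. qz_trunc q (ks[i := ks ! i + 1]) N"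
  let ?R = "\<lambda>N. \<Sum>i<length ks. \<Sum>a<ks ! i - 1.
      qz_trunc q (take i ks @ [ks ! i - a, a + 1] @ drop (i + 1) ks) N"
  let ?t = "qz_term q k"
  have IH: "?R n = ?L n + qz_conv q ks n - qz_harmonic q n * qz_trunc q ks n" for n
    using Cons by simp
  have "(\<Sum>i<length (k # ks). \<Sum>a<(k # ks) ! i - 1. qz_trunc q (take i (k # ks) @
        [(k # ks) ! i - a, a + 1] @ drop (i + 1) (k # ks)) N) =
      (\<Sum>a<k - 1. qz_trunc q ((k - a) # (a + 1) # ks) N) +
      (\<Sum>i<length ks. \<Sum>a<ks ! i - 1. \<Sum>n<N. ?t n *
        qz_trunc q (take i ks @ [ks ! i - a, a + 1] @ drop (i + 1) ks) n)"
    by (simp add: sum.lessThan_Suc_shift del: sum.lessThan_Suc)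
  also have "(\<Sum>i<length ks. \<Sum>a<ks ! i - 1. \<Sum>n<N. ?t n *
        qz_trunc q (take i ks @ [ks ! i - a, a + 1] @ drop (i + 1) ks) n) = (\<Sum>n<N. ?t n * ?R n)"
    unfolding sum_distrib_left by (subst sum.swap[of _ "{..<N}"], subst sum.swap[of _ "{..<N}"]) simp
  also have "\<dots> = (\<Sum>n<N. ?t n * ?L n) + (\<Sum>n<N. ?t n * qz_conv q ks n)
      - (\<Sum>n<N. ?t n * qz_trunc q ks n * qz_harmonic q n)"
    unfolding IH by (simp add: algebra_simps sum.distrib sum_subtractf)
  \<comment> \<open>The tail convolution from the induction hypothesis cancels the one from the
    head, leaving only consecutive harmonic sums.\<close>
  also have "(\<Sum>a<k - 1. qz_trunc q ((k - a) # (a + 1) # ks) N) + \<dots> =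
      qz_conv q (k # ks) N - qz_harmonic q N * qz_trunc q (k # ks) N
      + ((\<Sum>n<N. ?t n * qz_trunc q ks n * qz_harmonic q (Suc n))
         - (\<Sum>n<N. ?t n * qz_trunc q ks n * qz_harmonic q n)) + (\<Sum>n<N. ?t n * ?L n)"
    unfolding trunc_hoffman_head[OF q k] by (simp only: algebra_simps)
  \<comment> \<open>Consecutive harmonic sums differ by A(n), which raises the exponent k by one:
    this is the summand in which the first entry is incremented.\<close>
  also have "(\<Sum>n<N. ?t n * qz_trunc q ks n * qz_harmonic q (Suc n))
         - (\<Sum>n<N. ?t n * qz_trunc q ks n * qz_harmonic q n) = qz_trunc q ((k + 1) # ks) N"
    using k by (simp add: sum_subtractf[symmetric] qz_harmonic_def qz_term_Suc' algebra_simps)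
  also have "(\<Sum>n<N. ?t n * ?L n) = (\<Sum>i<length ks. \<Sum>n<N. ?t n * qz_trunc q (ks[i := ks ! i + 1]) n)"
    unfolding sum_distrib_left by (rule sum.swap)
  finally show ?case
    by (simp add: sum.lessThan_Suc_shift del: sum.lessThan_Suc)
qed

section \<open>Estimates and convergence\<close>

lemma norm_q_int_lower_bound:
  assumes q: "norm q < 1"
  shows "\<exists>c>0. \<forall>n>0. c \<le> norm (q_int q n)"
proof (intro exI conjI allI impI)
  have "q \<noteq> 1"
    using q by auto
  then show "0 < (1 - norm q) / norm (1 - q)"
    using q by (intro divide_pos_pos) auto
  show "(1 - norm q) / norm (1 - q) \<le> norm (q_int q n)" if "0 < n" for n
  proof -
    have "norm (q ^ n) \<le> norm q"
      using q that power_decreasing[of 1 n "norm q"] by (simp add: norm_power)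
    then have "1 - norm q \<le> norm (1 - q ^ n)"
      using norm_triangle_ineq2[of 1 "q ^ n"] by simp
    then show ?thesis
      unfolding q_int_def norm_divide by (intro divide_right_mono) auto
  qed
qed

text \<open>The exponent \<open>e\<close> is independent of \<open>n\<close> and \<open>k\<close>,
  so one estimate covers both \<open>qz_term\<close> and \<open>qz_ratio\<close>.\<close>

lemma norm_power_div_q_int_bound:
  assumes q: "norm q < 1" and k: "0 < k"
  shows "\<exists>K\<ge>0. \<forall>e n. norm (q ^ e / q_int q n ^ k) \<le> K * norm q ^ e"
proof -
  obtain c where c: "0 < c" "\<forall>n>0. c \<le> norm (q_int q n)"
    using norm_q_int_lower_bound[OF q] by blast
  have "norm (q ^ e / q_int q n ^ k) \<le> inverse (c ^ k) * norm q ^ e" for e n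
  proof (cases "n = 0")
    \<comment> \<open>Here [0]^k = 0 as k > 0, and division by zero gives 0.\<close>
    case True
    then show ?thesis
      using c(1) k by (simp add: q_int_def zero_power)
  next
    case False
    then have "c ^ k \<le> norm (q_int q n) ^ k"
      using c by (intro power_mono) auto
    then have "inverse (norm (q_int q n) ^ k) \<le> inverse (c ^ k)"
      using c(1) by (intro le_imp_inverse_le) auto
    then have "norm q ^ e * inverse (norm (q_int q n) ^ k) \<le> norm q ^ e * inverse (c ^ k)"
      by (intro mult_left_mono) auto
    then show ?thesis
      by (simp only: norm_mult norm_inverse norm_power divide_inverse mult.commute)
  qed
  moreover have "0 \<le> inverse (c ^ k)"
    using c(1) by simp
  ultimately show ?thesis
    by blast
qed

lemma norm_qz_term_bound:
  assumes "norm q < 1" and "0 < k"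
  shows "\<exists>K\<ge>0. \<forall>n. norm (qz_term q k n) \<le> K * norm q ^ ((k - 1) * n)"
  using norm_power_div_q_int_bound[OF assms] unfolding qz_term_def by blast

lemma norm_qz_ratio_bound:
  assumes "norm q < 1"
  shows "\<exists>K\<ge>0. \<forall>n. norm (qz_ratio q n) \<le> K * norm q ^ n"
  using norm_power_div_q_int_bound[OF assms zero_less_one]
  unfolding qz_ratio_def power_one_right by blast

lemma norm_trunc_sum_le:
  fixes t :: "nat \<Rightarrow> nat \<Rightarrow> complex"
  shows "norm (trunc_sum t ks N) \<le> trunc_sum (\<lambda>k n. norm (t k n)) ks N"
proof (induction ks arbitrary: N)
  case (Cons k ks)
  have "norm (trunc_sum t (k # ks) N) \<le> (\<Sum>n<N. norm (t k n * trunc_sum t ks n))"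
    by (simp add: norm_sum)
  also have "\<dots> \<le> trunc_sum (\<lambda>k n. norm (t k n)) (k # ks) N"
    using Cons by (auto simp: norm_mult intro!: sum_mono mult_left_mono)
  finally show ?case .
qed simp

text \<open>An entry 1 in the tail gives no decay. Each summand is therefore only bounded by a
  constant, and every level of nesting costs a factor N.\<close>

lemma trunc_norm_polynomial_bound:
  assumes q: "norm q < 1" and "\<forall>k\<in>set ks. 0 < k"
  shows "\<exists>C\<ge>0. \<forall>N. trunc_sum (\<lambda>k n. norm (qz_term q k n)) ks N \<le> C * real N ^ length ks"
  using assms(2)
proof (induction ks)
  case (Cons k ks)
  then obtain C where C: "0 \<le> C" "\<And>N. trunc_sum (\<lambda>k n. norm (qz_term q k n)) ks N \<le> C * real N ^ length ks"
    by auto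
  from Cons.prems have "0 < k" by simp
  then obtain K where K: "0 \<le> K" "\<And>n. norm (qz_term q k n) \<le> K * norm q ^ ((k - 1) * n)"
    using norm_qz_term_bound[OF q] by blast
  have t: "norm (qz_term q k n) \<le> K" for n
  proof -
    have "norm q ^ ((k - 1) * n) \<le> 1"
      using q by (intro power_le_one) auto
    then show ?thesis
      using order.trans[OF K(2) mult_left_mono[OF _ K(1), where b = 1]] by simp
  qed
  have "trunc_sum (\<lambda>k n. norm (qz_term q k n)) (k # ks) N \<le> (K * C) * real N ^ length (k # ks)" for N
  proof -
    have "trunc_sum (\<lambda>k n. norm (qz_term q k n)) (k # ks) N \<le> (\<Sum>n<N. K * (C * real N ^ length ks))"
      unfolding trunc_sum.simps
    proof (rule sum_mono)
      fix n assume n: "n \<in> {..<N}"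
      have "trunc_sum (\<lambda>k n. norm (qz_term q k n)) ks n \<le> C * real n ^ length ks"
        by (rule C)
      also have "\<dots> \<le> C * real N ^ length ks"
        using C(1) n by (intro mult_left_mono power_mono) auto
      finally show "norm (qz_term q k n) * trunc_sum (\<lambda>k n. norm (qz_term q k n)) ks n
          \<le> K * (C * real N ^ length ks)"
        using t[of n] C(1) K(1) order.trans[OF norm_ge_zero norm_trunc_sum_le[of "qz_term q" ks n]]
        by (intro mult_mono) auto
    qed
    then show ?thesis by (simp add: mult_ac)
  qed
  moreover have "0 \<le> K * C" using K C by simp
  ultimately show ?case by blast
qed (auto intro: exI[of _ 1])

text \<open>Root test: the n-th root of n tends to 1, so the polynomial factor does not affect the
  limit \<open>c\<close>.\<close>

lemma summable_polynomial_geometric: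
  fixes c :: real
  assumes "0 < c" "c < 1"
  shows "summable (\<lambda>n. real n ^ r * c ^ n)"
proof (rule root_test_convergence)
  have "(\<lambda>n. root n (real n) ^ r * c) \<longlonglongrightarrow> 1 ^ r * c"
    by (intro tendsto_intros LIMSEQ_root)
  moreover have "\<forall>\<^sub>F n in sequentially.
      root n (real n) ^ r * c = root n (norm (real n ^ r * c ^ n))"
    using eventually_gt_at_top[of 0]
  proof eventually_elim
    case (elim n)
    then show ?case
      using assms by (simp add: real_root_mult real_root_power[symmetric] real_root_power_cancel
          abs_mult)
  qed
  ultimately show "(\<lambda>n. root n (norm (real n ^ r * c ^ n))) \<longlonglongrightarrow> c"
    by (simp add: tendsto_cong)
qed (use assms in simp)

text \<open>A leading entry of at least 2 supplies the decay |q|^n, which beats the polynomial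
  growth of the tail.\<close>

lemma summable_trunc_norm:
  assumes q: "q \<noteq> 0" "norm q < 1" and k: "2 \<le> k" and ks: "\<forall>k\<in>set ks. 0 < k"
  shows "summable (\<lambda>n. norm (qz_term q k n) * trunc_sum (\<lambda>k n. norm (qz_term q k n)) ks n)"
proof -
  obtain C where C: "0 \<le> C" "\<And>N. trunc_sum (\<lambda>k n. norm (qz_term q k n)) ks N \<le> C * real N ^ length ks"
    using trunc_norm_polynomial_bound[OF q(2) ks] by auto
  have "0 < k" using k by simp
  then obtain K where K: "0 \<le> K" "\<And>n. norm (qz_term q k n) \<le> K * norm q ^ ((k - 1) * n)"
    using norm_qz_term_bound[OF q(2)] by blast
  have nn: "0 \<le> trunc_sum (\<lambda>k n. norm (qz_term q k n)) ks n" for n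
    using order.trans[OF norm_ge_zero norm_trunc_sum_le] .
  have bound: "norm (norm (qz_term q k n) * trunc_sum (\<lambda>k n. norm (qz_term q k n)) ks n)
      \<le> K * C * (real n ^ length ks * norm q ^ n)" for n
  proof -
    have "norm q ^ ((k - 1) * n) \<le> norm q ^ n"
      using q k by (intro power_decreasing) auto
    then have "norm (qz_term q k n) \<le> K * norm q ^ n"
      using order.trans[OF K(2) mult_left_mono[OF _ K(1)]] by blast
    then have "norm (qz_term q k n) * trunc_sum (\<lambda>k n. norm (qz_term q k n)) ks n
        \<le> (K * norm q ^ n) * (C * real n ^ length ks)"
      by (rule mult_mono[OF _ C(2) _ nn]) (rule mult_nonneg_nonneg[OF K(1)], rule zero_le_power, rule norm_ge_zero)
    also have "\<dots> = K * C * (real n ^ length ks * norm q ^ n)"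
      by (simp only: mult_ac)
    finally show ?thesis
      by (simp only: real_norm_def abs_mult abs_norm_cancel abs_of_nonneg[OF nn])
  qed
  have "summable (\<lambda>n. K * C * (real n ^ length ks * norm q ^ n))"
    using q by (intro summable_mult[OF summable_polynomial_geometric]) auto
  then show ?thesis
    by (rule summable_comparison_test') (rule bound)
qed

lemma admissible_Cons: "admissible (k # ks) \<longleftrightarrow> 2 \<le> k \<and> (\<forall>k\<in>set ks. 0 < k)"
  by (auto simp: admissible_def)

lemma qz_trunc_tendsto:
  assumes q: "q \<noteq> 0" "norm q < 1" and "admissible ks"
  shows "qz_trunc q ks \<longlonglongrightarrow> qzeta q ks"
proof -
  obtain k ks' where ks: "ks = k # ks'" "2 \<le> k" "\<forall>k\<in>set ks'. 0 < k"
    using assms(3) admissible_Cons by (cases ks) (auto simp: admissible_def)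
  have nn: "0 \<le> trunc_sum (\<lambda>k n. norm (qz_term q k n)) ks' n" for n
    using order.trans[OF norm_ge_zero norm_trunc_sum_le] .
  show ?thesis
    unfolding qzeta_eq
  proof (rule infsum_decreasing_tuples)
    show "qz_term q k 0 = 0" if "k \<in> set ks" for k
      using that assms(3) by (simp add: admissible_def)
    show "trunc_sum (\<lambda>k n. norm (qz_term q k n)) ks N \<le>
        (\<Sum>n. norm (qz_term q k n) * trunc_sum (\<lambda>k n. norm (qz_term q k n)) ks' n)" for N
      unfolding ks(1) trunc_sum.simps
      using summable_trunc_norm[OF q ks(2,3)] nn by (intro sum_le_suminf) auto
  qed
qed

lemma qz_conv_error_tendsto:
  assumes q: "q \<noteq> 0" "norm q < 1" and "admissible ks"
  shows "(\<lambda>N. qz_conv q ks N - qz_harmonic q N * qz_trunc q ks N) \<longlonglongrightarrow> 0"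
proof -
  obtain k ks' where ks: "ks = k # ks'" "2 \<le> k" "\<forall>k\<in>set ks'. 0 < k"
    using assms(3) admissible_Cons by (cases ks) (auto simp: admissible_def)
  \<comment> \<open>The truncated sums of \<open>ks\<close> are the partial sums of
    \<open>z\<close>, so the depth plays no further role in the limit.\<close>
  define z where "z n = qz_term q k n * qz_trunc q ks' n" for n
  have z: "summable (\<lambda>n. norm (z n))"
  proof (rule summable_comparison_test'[OF summable_trunc_norm[OF q ks(2,3)]])
    show "norm (norm (z n)) \<le> norm (qz_term q k n) * trunc_sum (\<lambda>k n. norm (qz_term q k n)) ks' n" for n
      by (simp add: z_def norm_mult mult_left_mono norm_trunc_sum_le)
  qed
  have A: "summable (\<lambda>n. norm (qz_ratio q n))"
  proof -
    obtain K where "\<And>n. norm (qz_ratio q n) \<le> K * norm q ^ n"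
      using norm_qz_ratio_bound[OF q(2)] by blast
    then have K: "norm (norm (qz_ratio q n)) \<le> K * norm q ^ n" for n
      unfolding real_norm_def abs_norm_cancel .
    have "summable (\<lambda>n. K * norm q ^ n)"
      using q by (intro summable_mult summable_geometric) auto
    then show ?thesis
      by (rule summable_comparison_test') (rule K)
  qed
  \<comment> \<open>Absolute convergence of both series identifies the limit of the convolution with
    the product of the sums, which is also the limit of the subtracted product.\<close>
  have "(\<lambda>N. \<Sum>n<N. \<Sum>i\<le>n. qz_ratio q i * z (n - i)) \<longlonglongrightarrow> suminf (qz_ratio q) * suminf z"
    using Cauchy_product_sums[OF A z] by (simp add: sums_def)
  then have "qz_conv q ks \<longlonglongrightarrow> suminf (qz_ratio q) * suminf z"
    unfolding ks(1) z_def qz_conv_Cons[symmetric] by simp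
  moreover have "qz_harmonic q \<longlonglongrightarrow> suminf (qz_ratio q)"
    unfolding qz_harmonic_def using summable_LIMSEQ[OF summable_norm_cancel[OF A]] .
  moreover have "qz_trunc q ks = (\<lambda>N. \<Sum>n<N. z n)"
    by (simp add: ks(1) z_def fun_eq_iff)
  then have "qz_trunc q ks \<longlonglongrightarrow> suminf z"
    using summable_LIMSEQ[OF summable_norm_cancel[OF z]] by simp
  ultimately show ?thesis
    by (auto intro!: tendsto_eq_intros)
qed

section \<open>Passage to the limit\<close>

lemma admissible_increment:
  assumes "admissible ks" "i < length ks"
  shows "admissible (ks[i := ks ! i + 1])"
  using assms set_update_subset_insert[of ks i "ks ! i + 1"]
  by (cases ks; cases i) (auto simp: admissible_Cons dest!: set_mp[OF set_update_subset_insert])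

text \<open>The range of \<open>a\<close> keeps k_i - a at least 2, which matters when the first
  entry is split; later splits leave the first entry alone.\<close>

lemma admissible_split:
  assumes "admissible ks" "i < length ks" "a < ks ! i - 1"
  shows "admissible (take i ks @ [ks ! i - a, a + 1] @ drop (i + 1) ks)"
  using assms by (cases ks; cases i) (auto simp: admissible_Cons dest: in_set_takeD in_set_dropD)

theorem proposition7:
  fixes q :: complex and ks :: "nat list"
  assumes "0 < norm q" and "norm q < 1"
    and "admissible ks"
  shows "(\<Sum>i<length ks. qzeta q (ks[i := ks ! i + 1])) =
         (\<Sum>i\<in>{i. i < length ks \<and> 2 \<le> ks ! i}. \<Sum>a=0..ks ! i - 2.
            qzeta q (take i ks @ [ks ! i - a, a + 1] @ drop (i + 1) ks))"
proof -
  have q: "q \<noteq> 0" "norm q < 1" using assms by auto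
  have pos: "\<forall>k\<in>set ks. 0 < k" using assms(3) by (simp add: admissible_def)
  let ?s = "\<lambda>i a. take i ks @ [ks ! i - a, a + 1] @ drop (i + 1) ks"
  have "(\<lambda>N. (\<Sum>i<length ks. qz_trunc q (ks[i := ks ! i + 1]) N)
        + (qz_conv q ks N - qz_harmonic q N * qz_trunc q ks N))
      \<longlonglongrightarrow> (\<Sum>i<length ks. qzeta q (ks[i := ks ! i + 1])) + 0"
    by (intro tendsto_add tendsto_sum qz_trunc_tendsto[OF q] qz_conv_error_tendsto[OF q]
        admissible_increment assms(3)) auto
  moreover have "(\<lambda>N. \<Sum>i<length ks. \<Sum>a<ks ! i - 1. qz_trunc q (?s i a) N)
      \<longlonglongrightarrow> (\<Sum>i<length ks. \<Sum>a<ks ! i - 1. qzeta q (?s i a))"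
    by (intro tendsto_sum qz_trunc_tendsto[OF q] admissible_split assms(3)) auto
  ultimately have "(\<Sum>i<length ks. qzeta q (ks[i := ks ! i + 1])) =
      (\<Sum>i<length ks. \<Sum>a<ks ! i - 1. qzeta q (?s i a))"
    unfolding trunc_hoffman[OF q(2) pos] by (auto simp: algebra_simps dest: LIMSEQ_unique)
  \<comment> \<open>For k_i = 1 the range a < k_i - 1 is empty.\<close>
  also have "\<dots> = (\<Sum>i\<in>{i. i < length ks \<and> 2 \<le> ks ! i}. \<Sum>a<ks ! i - 1. qzeta q (?s i a))"
    by (rule sum.mono_neutral_right) (auto elim!: sum.not_neutral_contains_not_neutral)
  \<comment> \<open>The two ranges of \<open>a\<close> agree only once k_i \<ge> 2 is known: for k_i
    = 1 truncated subtraction would admit a = 0.\<close>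
  also have "\<dots> = (\<Sum>i\<in>{i. i < length ks \<and> 2 \<le> ks ! i}. \<Sum>a=0..ks ! i - 2. qzeta q (?s i a))"
    by (intro sum.cong) auto
  finally show ?thesis .
qed

end
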